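(* For each integer $N\ge 3$, let $x_{N,1},\ldots,x_{N,N}$ be the unique monotonic zero-mean solution of the recursion relation $$x_{N,n+1}=x_{N,n}-\frac{1}{x_{N,1}+\cdots+x_{N,n}},\qquad n=1,\ldots,N-1,$$ and let $\mathbb{P}_N$ be its empirical distribution, $\mathbb{P}_N(A)=\#\{n\colon x_{N,n}\in A\}/N$ for Borel sets $A\subset\mathbb{R}$. Then $\mathbb{P}_N$ converges in distribution (weakly) to the standard Gaussian distribution $\mathcal{N}(0,1)$ as $N\to\infty$.
   Context: A solution of the recursion is a finite sequence of real numbers $x_{N,1},\ldots,x_{N,N}$ for which all partial sums $x_{N,1}+\cdots+x_{N,n}$, $1\le n\le N-1$, are nonzero and the recursion holds for $n=1,\ldots,N-1$. Zero-mean means $x_{N,1}+\cdots+x_{N,N}=0$. Monotonic means that the finite sequence $n\mapsto x_{N,n}$ is monotonic (any monotonic solution is automatically strictly monotonic). For each $N\ge3$ there is exactly one strictly decreasing zero-mean solution, and it is symmetric ($x_{N,n}=-x_{N,N+1-n}$); reversing its order gives the increasing one. So "the unique monotonic zero-mean solution" refers to this configuration, uniquely determined up to reversal of order, and $\mathbb{P}_N$ does not depend on the order. *)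

theory Defs
  imports "HOL-Probability.Probability"
begin

text \<open>
  A finite sequence of length \<open>N\<close> is a function \<open>x :: nat \<Rightarrow> real\<close> of which only the values on
  \<open>{1..N}\<close> matter.
\<close>

definition is_solution :: "nat \<Rightarrow> (nat \<Rightarrow> real) \<Rightarrow> bool" where
  "is_solution N x \<longleftrightarrow>
     (\<forall>n\<in>{1..N - 1}. (\<Sum>i=1..n. x i) \<noteq> 0 \<and> x (n + 1) = x n - 1 / (\<Sum>i=1..n. x i))"

definition zero_mean :: "nat \<Rightarrow> (nat \<Rightarrow> real) \<Rightarrow> bool" where
  "zero_mean N x \<longleftrightarrow> (\<Sum>i=1..N. x i) = 0"

definition monotonic :: "nat \<Rightarrow> (nat \<Rightarrow> real) \<Rightarrow> bool" where
  "monotonic N x \<longleftrightarrow> mono_on {1..N} x \<or> antimono_on {1..N} x"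

definition monotonic_zero_mean_solution :: "nat \<Rightarrow> (nat \<Rightarrow> real) \<Rightarrow> bool" where
  "monotonic_zero_mean_solution N x \<longleftrightarrow> is_solution N x \<and> zero_mean N x \<and> monotonic N x"

definition empirical_distribution :: "nat \<Rightarrow> (nat \<Rightarrow> real) \<Rightarrow> real measure" where
  "empirical_distribution N x = distr (uniform_count_measure {1..N}) borel x"

lemma measure_empirical_distribution:
  assumes "N \<ge> 1" and "A \<in> sets borel"
  shows "measure (empirical_distribution N x) A = card {n\<in>{1..N}. x n \<in> A} / N"
proof -
  have eq: "x -` A \<inter> {1..N} = {n\<in>{1..N}. x n \<in> A}" by auto
  have "measure (empirical_distribution N x) A
      = measure (uniform_count_measure {1..N}) (x -` A \<inter> {1..N})"
    unfolding empirical_distribution_def using assms(2)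
    by (subst measure_distr) (auto simp: space_uniform_count_measure measurable_def
        sets_uniform_count_measure)
  also have "\<dots> = card {n\<in>{1..N}. x n \<in> A} / N"
    unfolding eq by (subst measure_uniform_count_measure) auto
  finally show ?thesis .
qed

lemma real_distribution_empirical_distribution:
  assumes "N \<ge> 1"
  shows "real_distribution (empirical_distribution N x)"
proof -
  interpret prob_space "uniform_count_measure {1..N}"
    using assms by (intro prob_space_uniform_count_measure) auto
  show ?thesis
    unfolding empirical_distribution_def
    by (rule real_distribution_distr)
      (auto simp: measurable_def space_uniform_count_measure sets_uniform_count_measure)
qed

end

theory Submission
  imports Defs
begin

text \<open>
  The partial sums of a decreasing zero-mean solution are exactly the positive solutions of the
  discrete boundary value problem \<open>S (i + 1) - 2 S i + S (i - 1) = - 1 / S i\<close>, \<open>S 0 = S N = 0\<close>.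
  Existence follows by shooting in the initial slope \<open>S 1\<close>, and uniqueness from a maximum principle.

  For the limit law, summation by parts together with \<open>x n - x (n + 1) = 1 / S n\<close> turns
  \<open>\<Sum> x n * f (x n)\<close> into \<open>\<Sum> f' (x n)\<close> up to an error that telescopes to a multiple of \<open>x 1 - x N\<close>.
  Taking \<open>f x = x\<close> gives \<open>\<Sum> (x n)\<^sup>2 = N - 1\<close>, hence \<open>\<bar>x 1 - x N\<bar> = O(sqrt N)\<close>; taking \<open>f x = exp (i t x)\<close>
  shows that the characteristic function approximately satisfies \<open>\<phi>' = - t \<phi>\<close>, with an error of
  order \<open>1 / sqrt N\<close>. Levy's continuity theorem concludes.
\<close>

section \<open>The boundary value problem for the partial sums\<close>

definition positive_profile :: "nat \<Rightarrow> (nat \<Rightarrow> real) \<Rightarrow> bool" where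
  "positive_profile N S \<longleftrightarrow> S 0 = 0 \<and> S N = 0 \<and>
     (\<forall>i. 0 < i \<and> i < N \<longrightarrow> 0 < S i \<and> S (i + 1) = 2 * S i - S (i - 1) - 1 / S i)"

text \<open>Maximum principle: \<open>- 1 / s\<close> increases on \<open>s > 0\<close>, so at a
  positive interior maximum of \<open>S - T\<close> the second difference would be positive.\<close>

lemma positive_profile_le:
  assumes S: "positive_profile N S" and T: "positive_profile N T" and "i \<le> N"
  shows "S i \<le> T i"
proof (rule ccontr)
  assume neg: "\<not> S i \<le> T i"
  define D where "D j = S j - T j" for j
  have "Max (D ` {..N}) \<in> D ` {..N}"
    by (intro Max_in) auto
  then obtain m where m: "m \<le> N" "D m = Max (D ` {..N})" by fastforce
  have max: "D j \<le> D m" if "j \<le> N" for j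
    unfolding m(2) using that by (intro Max_ge) auto
  have "D m > 0"
    using max[OF \<open>i \<le> N\<close>] neg by (simp add: D_def)
  then have "m \<noteq> 0" "m \<noteq> N"
    using S T unfolding D_def positive_profile_def by (metis diff_self less_irrefl)+
  then have m0: "0 < m" "m < N"
    using m(1) by auto
  have "0 < T m" "T m < S m"
    using T m0 \<open>D m > 0\<close> by (auto simp: D_def positive_profile_def)
  then have "1 / S m < 1 / T m"
    by (intro divide_strict_left_mono) auto
  moreover have "D (m + 1) = 2 * D m - D (m - 1) + (1 / T m - 1 / S m)"
    using S T m0 by (simp add: D_def positive_profile_def)
  moreover have "D (m + 1) \<le> D m" "D (m - 1) \<le> D m"
    using max[of "m + 1"] max[of "m - 1"] m0 by auto
  ultimately show False by linarith
qed

lemma positive_profile_unique: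
  assumes "positive_profile N S" and "positive_profile N T" and "i \<le> N"
  shows "S i = T i"
  by (intro antisym positive_profile_le[of N] assms)

text \<open>The equation is invariant under reflection. With uniqueness this gives
  \<open>S i = S (N - i)\<close>, which later identifies the increasing solution with the reversed
  decreasing one.\<close>

lemma positive_profile_rev:
  assumes "positive_profile N S"
  shows "positive_profile N (\<lambda>i. S (N - i))"
  unfolding positive_profile_def
proof (intro conjI allI impI)
  fix i assume i: "0 < i \<and> i < N"
  then have "0 < N - i \<and> N - i < N" by auto
  with assms have 1: "0 < S (N - i)"
    "S (N - i + 1) = 2 * S (N - i) - S (N - i - 1) - 1 / S (N - i)"
    by (auto simp: positive_profile_def)
  from 1(1) show "0 < S (N - i)" .
  have "N - (i + 1) = N - i - 1" "N - (i - 1) = N - i + 1" using i by auto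
  with 1(2) show "S (N - (i + 1)) = 2 * S (N - i) - S (N - (i - 1)) - 1 / S (N - i)"
    by simp
qed (use assms in \<open>auto simp: positive_profile_def\<close>)

section \<open>Shooting in the initial slope\<close>

text \<open>Division by zero yields 0, so the recursion is total; a value is meaningful only while
  the earlier ones at positive indices are nonzero.\<close>

fun shoot :: "nat \<Rightarrow> real \<Rightarrow> real" where
  "shoot 0 a = 0"
| "shoot (Suc 0) a = a"
| "shoot (Suc (Suc n)) a = 2 * shoot (Suc n) a - shoot n a - 1 / shoot (Suc n) a"

lemma shoot_strict_mono:
  assumes "a < b" and pos: "\<And>i. 0 < i \<Longrightarrow> i \<le> n \<Longrightarrow> 0 < shoot i a"
  shows "shoot (Suc n) a < shoot (Suc n) b"
proof -
  \<comment> \<open>The induction carries that the gap between the trajectories grows: at positive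
    values the higher one loses less slope per step.\<close>
  have "i \<le> n \<Longrightarrow> shoot i a \<le> shoot i b \<and>
      shoot i b - shoot i a < shoot (Suc i) b - shoot (Suc i) a" for i
  proof (induction i)
    case 0
    then show ?case using \<open>a < b\<close> by simp
  next
    case (Suc i)
    then have le: "shoot (Suc i) a < shoot (Suc i) b" by auto
    have "0 < shoot (Suc i) a" using pos[of "Suc i"] Suc.prems by simp
    with le have "1 / shoot (Suc i) b < 1 / shoot (Suc i) a"
      by (intro divide_strict_left_mono) auto
    with le Suc show ?case by auto
  qed
  from this[of n] show ?thesis by simp
qed

lemma shoot_pos_mono:
  assumes "a \<le> b" and pos: "\<And>i. 0 < i \<Longrightarrow> i \<le> n \<Longrightarrow> 0 < shoot i a" and "0 < i" "i \<le> n"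
  shows "0 < shoot i b"
proof (cases "a = b")
  case False
  obtain j where j: "i = Suc j" using \<open>0 < i\<close> by (cases i) auto
  have "shoot i a < shoot i b"
    unfolding j using assms False by (intro shoot_strict_mono pos) (auto simp: j)
  moreover have "0 < shoot i a" using assms by simp
  ultimately show ?thesis by linarith
qed (use assms in auto)

text \<open>While the values are at least 1, each step lowers the slope by at most 1, so the initial
  slope \<open>n\<close> stays positive up to index \<open>n\<close>.\<close>

lemma shoot_pos_large:
  assumes "0 < i" "i \<le> n"
  shows "0 < shoot i (real n)"
proof -
  have "i < n \<Longrightarrow> real i \<le> shoot i n \<and> real (n - i) \<le> shoot (Suc i) n - shoot i n" for i
  proof (induction i)
    case (Suc i)
    then have "1 \<le> shoot (Suc i) n - shoot i n" by auto
    with Suc have ge: "real (Suc i) \<le> shoot (Suc i) n" by auto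
    then have "1 / shoot (Suc i) n \<le> 1" by (simp add: field_simps)
    moreover have "real (n - i) = real (n - Suc i) + 1" using Suc.prems by auto
    ultimately have "real (n - Suc i) \<le> shoot (Suc (Suc i)) n - shoot (Suc i) n"
      using Suc unfolding shoot.simps by linarith
    with ge show ?case by simp
  qed auto
  from this[of "i - 1"] assms show ?thesis by (cases i) (auto simp del: shoot.simps)
qed

lemma continuous_on_shoot:
  assumes "\<And>a i. a \<in> A \<Longrightarrow> 0 < i \<Longrightarrow> i < n \<Longrightarrow> shoot i a \<noteq> 0"
  shows "continuous_on A (shoot n)"
  using assms
proof (induction n rule: less_induct)
  case (less n)
  consider "n = 0" | "n = Suc 0" | m where "n = Suc (Suc m)"
    by (metis not0_implies_Suc)
  then show ?case
  proof cases
    case 3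
    have "continuous_on A (shoot m)" "continuous_on A (shoot (Suc m))"
      by (rule less.IH; use less.prems 3 in auto)+
    then show ?thesis
      unfolding 3 shoot.simps using less.prems[of _ "Suc m"] 3
      by (intro continuous_intros) auto
  qed (simp_all add: continuous_on_id)
qed

text \<open>Induction on \<open>n\<close>: if slope \<open>c\<close> first returns to zero at
  \<open>n\<close>, slopes just above \<open>c\<close> are negative at \<open>Suc n\<close>, while
  slope \<open>Suc n\<close> is still positive there. The intermediate value theorem gives the next
  slope.\<close>

lemma shoot_zero_exists:
  assumes "1 \<le> n"
  shows "\<exists>c. (\<forall>i. 0 < i \<and> i < n \<longrightarrow> 0 < shoot i c) \<and> shoot n c = 0"
  using assms
proof (induction n rule: nat_induct_at_least)
  case base
  then show ?case by (intro exI[of _ 0]) auto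
next
  case (Suc n)
  then obtain c where c: "\<And>i. 0 < i \<Longrightarrow> i < n \<Longrightarrow> 0 < shoot i c" "shoot n c = 0" by blast
  define M where "M = real (Suc n)"
  \<comment> \<open>Otherwise positivity at slope \<open>M\<close> would persist at the larger slope
    \<open>c\<close>, where the trajectory vanishes at \<open>n\<close>.\<close>
  have "c < M"
  proof (rule ccontr)
    assume "\<not> c < M"
    then have "0 < shoot n c"
      using shoot_pos_mono[of M c n n] shoot_pos_large[of _ "Suc n"] Suc.hyps by (auto simp: M_def)
    with c show False by simp
  qed
  obtain m where m: "n = Suc m" using Suc.hyps by (cases n) auto
  have pos: "0 < shoot i a" if "c < a" "0 < i" "i \<le> n" for a i
  proof (cases "i = n")
    case True
    have "shoot (Suc m) c < shoot (Suc m) a"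
      using that c by (intro shoot_strict_mono) (auto simp: m)
    with c True show ?thesis by (simp add: m)
  next
    case False
    with that show ?thesis using shoot_pos_mono[of c a m i] c(1) by (auto simp: m)
  qed
  have nz: "shoot i a \<noteq> 0" if "c \<le> a" "0 < i" "i < n" for a i
    using that pos[of a i] c(1)[of i] by (cases "a = c") auto
  have cont_n: "continuous_on {c..} (shoot n)" and cont_m: "continuous_on {c..} (shoot m)"
    by (intro continuous_on_shoot nz; simp add: m)+
  have lim_n: "(shoot n \<longlongrightarrow> 0) (at_right c)" and lim_m: "(shoot m \<longlongrightarrow> shoot m c) (at_right c)"
    using cont_n cont_m c(2) unfolding continuous_on_def
    by (auto intro: tendsto_within_subset dest!: bspec[of _ _ c])
  \<comment> \<open>As \<open>a\<close> decreases to \<open>c\<close>, \<open>shoot n a\<close>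
    tends to 0 from above; its inverse blows up and outweighs the other terms of the
    recursion.\<close>
  have "filterlim (shoot n) (at_right 0) (at_right c)"
    unfolding filterlim_at
  proof
    show "eventually (\<lambda>a. shoot n a \<in> {0<..} \<and> shoot n a \<noteq> 0) (at_right c)"
      using eventually_at_right_less[of c]
    proof eventually_elim
      case (elim a)
      with pos[of a n] m show ?case by simp
    qed
  qed (rule lim_n)
  then have "filterlim (\<lambda>a. inverse (shoot n a)) at_top (at_right c)"
    by (rule filterlim_compose[OF filterlim_inverse_at_top_right])
  then have "filterlim (\<lambda>a. (- (2 * shoot n a - shoot m a)) + inverse (shoot n a)) at_top (at_right c)"
    by (intro filterlim_tendsto_add_at_top) (auto intro!: tendsto_eq_intros lim_n lim_m)
  then have "eventually (\<lambda>a. 0 < (- (2 * shoot n a - shoot m a)) + inverse (shoot n a)) (at_right c)"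
    by (simp add: filterlim_at_top_dense)
  moreover have "eventually (\<lambda>a. a \<in> {c<..<M}) (at_right c)"
    using \<open>c < M\<close> by (rule eventually_at_right_real)
  ultimately have "eventually (\<lambda>a. a \<in> {c<..<M} \<and> shoot (Suc n) a < 0) (at_right c)"
    by eventually_elim (simp add: m inverse_eq_divide)
  then obtain a where a: "c < a" "a < M" "shoot (Suc n) a < 0"
    using eventually_happens[of _ "at_right c"] by auto
  have "continuous_on {a..M} (shoot (Suc n))"
    by (intro continuous_on_shoot less_imp_neq[THEN not_sym] pos) (use a in auto)
  moreover have "0 < shoot (Suc n) M"
    unfolding M_def by (rule shoot_pos_large) auto
  ultimately obtain d where d: "a \<le> d" "shoot (Suc n) d = 0"
    using IVT'[of "shoot (Suc n)" a 0 M] a by auto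
  then show ?case
    using pos[of d] a c by (intro exI[of _ d]) auto
qed

lemma positive_profile_exists:
  assumes "2 \<le> N"
  shows "\<exists>S. positive_profile N S"
proof -
  obtain c where c: "\<And>i. 0 < i \<Longrightarrow> i < N \<Longrightarrow> 0 < shoot i c" "shoot N c = 0"
    using shoot_zero_exists[of N] assms by auto
  have "shoot (i + 1) c = 2 * shoot i c - shoot (i - 1) c - 1 / shoot i c" if "0 < i" for i
    using that by (cases i) auto
  with c show ?thesis
    by (intro exI[of _ "\<lambda>i. shoot i c"]) (auto simp: positive_profile_def)
qed

section \<open>Existence and uniqueness of monotonic solutions\<close>

text \<open>Either all terms up to \<open>n\<close> are nonnegative, or the tail after
  \<open>n\<close> is nonpositive and the zero total forces the claim.\<close>

lemma partial_sums_nonneg: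
  fixes x :: "nat \<Rightarrow> real"
  assumes anti: "antimono_on {1..N} x" and zero: "(\<Sum>i=1..N. x i) = 0" and n: "n \<in> {1..N}"
  shows "0 \<le> (\<Sum>i=1..n. x i)"
proof (cases "0 \<le> x n")
  case True
  have "0 \<le> x i" if "i \<in> {1..n}" for i
    using True monotone_onD[OF anti, of i n] that n by auto
  then show ?thesis by (intro sum_nonneg) auto
next
  case False
  have "x i \<le> 0" if "i \<in> {n+1..N}" for i
    using False monotone_onD[OF anti, of n i] that n by auto
  then have "(\<Sum>i=n+1..N. x i) \<le> 0" by (intro sum_nonpos) auto
  moreover have "(\<Sum>i=1..N. x i) = (\<Sum>i=1..n. x i) + (\<Sum>i=n+1..N. x i)"
    using n sum.ub_add_nat[of 1 n x "N - n"] by simp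
  ultimately show ?thesis using zero by simp
qed

lemma positive_profile_partial_sums:
  assumes sol: "is_solution N x" and zero: "zero_mean N x" and anti: "antimono_on {1..N} x"
  shows "positive_profile N (\<lambda>n. \<Sum>i=1..n. x i)"
  unfolding positive_profile_def
proof (intro conjI allI impI)
  fix n assume n: "0 < n \<and> n < N"
  then have mem: "n \<in> {1..N - 1}" by auto
  show "0 < (\<Sum>i=1..n. x i)"
    using sol partial_sums_nonneg[OF anti, of n] zero mem
    by (force simp: is_solution_def zero_mean_def less_le)
  obtain m where m: "n = Suc m" using n by (cases n) auto
  have "x (n + 1) = x n - 1 / (\<Sum>i=1..n. x i)"
    using sol mem by (auto simp: is_solution_def)
  then show "(\<Sum>i=1..n+1. x i) = 2 * (\<Sum>i=1..n. x i) - (\<Sum>i=1..n-1. x i) - 1 / (\<Sum>i=1..n. x i)"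
    by (simp add: m)
qed (use zero in \<open>auto simp: zero_mean_def\<close>)

lemma solution_of_positive_profile:
  assumes S: "positive_profile N S"
  defines "x \<equiv> \<lambda>n. S n - S (n - 1)"
  shows "is_solution N x" and "zero_mean N x" and "antimono_on {1..N} x"
    and "\<And>n. (\<Sum>i=1..n. x i) = S n"
proof -
  show sum: "(\<Sum>i=1..n. x i) = S n" for n
    using S by (induction n) (auto simp: x_def positive_profile_def)
  have decr: "0 < S n \<and> x (n + 1) = x n - 1 / S n" if "0 < n" "n < N" for n
    using S that by (auto simp: x_def positive_profile_def)
  show "is_solution N x"
    unfolding is_solution_def sum
  proof
    fix n assume "n \<in> {1..N - 1}"
    then have "0 < n" "n < N" by auto
    from decr[OF this] show "S n \<noteq> 0 \<and> x (n + 1) = x n - 1 / S n" by simp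
  qed
  show "zero_mean N x"
    unfolding zero_mean_def sum using S by (simp add: positive_profile_def)
  have "x n \<le> x m" if "m \<le> n" "0 < m" "n \<le> N" for m n
    using that
  proof (induction n rule: dec_induct)
    case (step n)
    moreover have "x (Suc n) \<le> x n" using decr[of n] step by auto
    ultimately show ?case by simp
  qed simp
  then show "antimono_on {1..N} x"
    by (intro monotone_onI) auto
qed

lemma is_solution_uminus:
  "is_solution N x \<Longrightarrow> is_solution N (\<lambda>n. - x n)"
  by (auto simp: is_solution_def sum_negf)

lemma decreasing_zero_mean_solution_unique:
  assumes S: "positive_profile N S"
    and y: "is_solution N y" "zero_mean N y" "antimono_on {1..N} y" and n: "n \<in> {1..N}"
  shows "y n = S n - S (n - 1)"
proof -
  have eq: "(\<Sum>i=1..k. y i) = S k" if "k \<le> N" for k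
    using positive_profile_unique[OF positive_profile_partial_sums[OF y] S that] .
  obtain m where m: "n = Suc m" using n by (cases n) auto
  show ?thesis using eq[of n] eq[of m] n by (simp add: m)
qed

lemma monotonic_zero_mean_solution_ex_unique:
  assumes "2 \<le> N"
  shows "\<exists>x. monotonic_zero_mean_solution N x \<and>
            (\<forall>y. monotonic_zero_mean_solution N y \<longrightarrow>
               (\<forall>n\<in>{1..N}. y n = x n) \<or> (\<forall>n\<in>{1..N}. y n = x (N + 1 - n)))"
proof -
  obtain S where S: "positive_profile N S" using positive_profile_exists[OF assms] by blast
  define x where "x n = S n - S (n - 1)" for n
  have "monotonic_zero_mean_solution N x"
    using solution_of_positive_profile[OF S]
    unfolding monotonic_zero_mean_solution_def monotonic_def x_def by blast
  moreover have "(\<forall>n\<in>{1..N}. y n = x n) \<or> (\<forall>n\<in>{1..N}. y n = x (N + 1 - n))"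
    if y: "monotonic_zero_mean_solution N y" for y
  proof (cases "antimono_on {1..N} y")
    case True
    with y decreasing_zero_mean_solution_unique[OF S, of y] show ?thesis
      by (auto simp: monotonic_zero_mean_solution_def x_def)
  next
    case False
    with y have mono: "mono_on {1..N} y"
      by (auto simp: monotonic_zero_mean_solution_def monotonic_def)
    \<comment> \<open>Negating \<open>y\<close> gives the decreasing solution; the reflection
      symmetry of \<open>S\<close> turns the negation into a reversal.\<close>
    have "y n = x (N + 1 - n)" if n: "n \<in> {1..N}" for n
    proof -
      have "- y n = S n - S (n - 1)"
      proof (rule decreasing_zero_mean_solution_unique[OF S _ _ _ n])
        show "is_solution N (\<lambda>n. - y n)" "zero_mean N (\<lambda>n. - y n)"
          using y by (auto simp: monotonic_zero_mean_solution_def is_solution_uminus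
              zero_mean_def sum_negf)
        show "antimono_on {1..N} (\<lambda>n. - y n)"
          using mono by (auto simp: monotone_on_def)
      qed
      moreover have "S n = S (N - n)" "S (n - 1) = S (N - (n - 1))"
        using n positive_profile_unique[OF S positive_profile_rev[OF S], of n]
          positive_profile_unique[OF S positive_profile_rev[OF S], of "n - 1"]
        unfolding atLeastAtMost_iff by linarith+
      moreover have "x (N + 1 - n) = S (N - (n - 1)) - S (N - n)"
      proof -
        have "N + 1 - n = N - (n - 1)" "N - (n - 1) - 1 = N - n" using n by auto
        then show ?thesis by (simp only: x_def)
      qed
      ultimately show ?thesis by linarith
    qed
    then show ?thesis by blast
  qed
  ultimately show ?thesis by blast
qed

section \<open>Convergence of the empirical distributions\<close>

text \<open>The algebra-valued \<open>f\<close> lets one identity serve both \<open>f = x\<close>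
  and complex exponentials.\<close>

lemma summation_by_parts:
  fixes x :: "nat \<Rightarrow> real" and f :: "nat \<Rightarrow> 'a :: real_algebra_1"
  shows "(\<Sum>n=1..Suc m. of_real (x n) * f n) =
     of_real (\<Sum>i=1..Suc m. x i) * f (Suc m) +
     (\<Sum>n=1..m. of_real (\<Sum>i=1..n. x i) * (f n - f (Suc n)))"
  by (induction m) (simp_all add: algebra_simps)

text \<open>With \<open>f = x\<close> the boundary term vanishes by zero mean, and each of the
  remaining \<open>N - 1\<close> summands is a partial sum times its reciprocal.\<close>

lemma zero_mean_solution_sum_squares:
  assumes sol: "is_solution N x" and zero: "zero_mean N x" and "1 \<le> N"
  shows "(\<Sum>n=1..N. (x n)\<^sup>2) = real N - 1"
proof -
  obtain m where m: "N = Suc m" using \<open>1 \<le> N\<close> by (cases N) auto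
  have "(\<Sum>n=1..N. (x n)\<^sup>2) = (\<Sum>n=1..m. (\<Sum>i=1..n. x i) * (x n - x (Suc n)))"
    using summation_by_parts[of x x m] zero
    by (simp add: m zero_mean_def power2_eq_square del: sum.cl_ivl_Suc)
  also have "\<dots> = (\<Sum>n=1..m. 1)"
    using sol by (intro sum.cong) (auto simp: is_solution_def m)
  finally show ?thesis by (simp add: m)
qed

text \<open>All increments have one sign, so the total variation telescopes. This controls the
  accumulated Taylor errors below.\<close>

lemma monotonic_sum_abs_diff:
  fixes x :: "nat \<Rightarrow> real"
  assumes "monotonic (Suc m) x"
  shows "(\<Sum>n=1..m. \<bar>x n - x (Suc n)\<bar>) = \<bar>x 1 - x (Suc m)\<bar>"
proof -
  have tele: "(\<Sum>n=1..m. x n - x (Suc n)) = x 1 - x (Suc m)" by (induction m) auto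
  have pairs: "n \<in> {1..Suc m} \<and> Suc n \<in> {1..Suc m}" if "n \<in> {1..m}" for n using that by auto
  have ends: "1 \<in> {1..Suc m}" "Suc m \<in> {1..Suc m}" by auto
  show ?thesis
  proof (cases "mono_on {1..Suc m} x")
    case True
    have "(\<Sum>n=1..m. \<bar>x n - x (Suc n)\<bar>) = (\<Sum>n=1..m. - (x n - x (Suc n)))"
      using monotone_onD[OF True, of n "Suc n" for n] pairs by (intro sum.cong) auto
    also have "\<dots> = \<bar>x 1 - x (Suc m)\<bar>"
      using tele monotone_onD[OF True ends] by (simp only: sum_negf) auto
    finally show ?thesis .
  next
    case False
    with assms have anti: "antimono_on {1..Suc m} x" by (simp add: monotonic_def)
    have "(\<Sum>n=1..m. \<bar>x n - x (Suc n)\<bar>) = (\<Sum>n=1..m. x n - x (Suc n))"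
      using monotone_onD[OF anti, of n "Suc n" for n] pairs by (intro sum.cong) auto
    also have "\<dots> = \<bar>x 1 - x (Suc m)\<bar>"
      using tele monotone_onD[OF anti ends] by auto
    finally show ?thesis .
  qed
qed

section \<open>Approximate Stein identity for exponentials\<close>

text \<open>First-order Taylor expansion in \<open>h = - t / s\<close>: the main term
  \<open>- \<i> * h * s\<close> equals \<open>\<i> * t\<close>, and the remainder is at most
  \<open>\<bar>s\<bar> * h\<^sup>2 / 2\<close>.\<close>

lemma stein_step:
  fixes s t y :: real
  assumes "s \<noteq> 0"
  shows "cmod (of_real s * (iexp (t * y) - iexp (t * (y - 1 / s))) - \<i> * of_real t * iexp (t * y))
      \<le> t\<^sup>2 / 2 * \<bar>1 / s\<bar>"
proof -
  define h where "h = - t / s"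
  have "cmod (iexp h - (1 + \<i> * of_real h)) \<le> h\<^sup>2 / 2"
    using iexp_approx1[of h 1] by (simp add: numeral_2_eq_2 power2_eq_square)
  then have R: "\<bar>s\<bar> * cmod (iexp h - (1 + \<i> * of_real h)) \<le> \<bar>s\<bar> * (h\<^sup>2 / 2)"
    by (intro mult_left_mono) auto
  have "iexp (t * (y - 1 / s)) = iexp (t * y) * iexp h"
    unfolding h_def exp_add[symmetric] by (simp add: algebra_simps)
  then have "of_real s * (iexp (t * y) - iexp (t * (y - 1 / s))) - \<i> * of_real t * iexp (t * y) =
      - (iexp (t * y) * of_real s * (iexp h - (1 + \<i> * of_real h)))"
    using assms by (simp add: h_def field_simps)
  then have "cmod (of_real s * (iexp (t * y) - iexp (t * (y - 1 / s))) - \<i> * of_real t * iexp (t * y)) =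
      \<bar>s\<bar> * cmod (iexp h - (1 + \<i> * of_real h))"
    by (simp only: norm_minus_cancel norm_mult norm_exp_i_times norm_of_real mult_1_left)
  also have "\<dots> \<le> \<bar>s\<bar> * (h\<^sup>2 / 2)" by (rule R)
  also have "\<dots> = t\<^sup>2 / 2 * \<bar>1 / s\<bar>"
    using assms by (simp add: h_def power_divide field_simps power2_eq_square abs_if)
  finally show ?thesis .
qed

lemma stein_bound:
  assumes x: "monotonic_zero_mean_solution N x" and "1 \<le> N"
  shows "cmod ((\<Sum>n=1..N. of_real (x n) * iexp (t * x n)) - \<i> * of_real t * (\<Sum>n=1..N. iexp (t * x n)))
      \<le> (t\<^sup>2 + \<bar>t\<bar>) * sqrt N"
proof -
  have sol: "is_solution N x" and zero: "zero_mean N x" and mon: "monotonic N x"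
    using x by (auto simp: monotonic_zero_mean_solution_def)
  obtain m where m: "N = Suc m" using \<open>1 \<le> N\<close> by (cases N) auto
  define S where "S n = (\<Sum>i=1..n. x i)" for n
  define f where "f n = iexp (t * x n)" for n
  have S: "S n \<noteq> 0" "x (Suc n) = x n - 1 / S n" if "n \<in> {1..m}" for n
    using sol that by (auto simp: is_solution_def S_def m)
  have "S N = 0" using zero by (simp add: S_def zero_mean_def)
  then have parts: "(\<Sum>n=1..N. of_real (x n) * f n) = (\<Sum>n=1..m. of_real (S n) * (f n - f (Suc n)))"
    using summation_by_parts[of x f m] unfolding m S_def by simp
  \<comment> \<open>A single square is bounded by the sum of squares \<open>N - 1\<close>; this is
    the source of the \<open>sqrt N\<close> in the bound.\<close>
  have abs_le: "\<bar>x n\<bar> \<le> sqrt N" if "n \<in> {1..N}" for n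
  proof -
    have "(x n)\<^sup>2 \<le> (\<Sum>n=1..N. (x n)\<^sup>2)" using that by (intro member_le_sum) auto
    also have "\<dots> \<le> N" using zero_mean_solution_sum_squares[OF sol zero \<open>1 \<le> N\<close>] by simp
    finally show ?thesis by (intro real_le_rsqrt) simp
  qed
  have "cmod ((\<Sum>n=1..N. of_real (x n) * f n) - \<i> * of_real t * (\<Sum>n=1..m. f n)) =
      cmod (\<Sum>n=1..m. of_real (S n) * (f n - f (Suc n)) - \<i> * of_real t * f n)"
    unfolding parts sum_subtractf sum_distrib_left ..
  also have "\<dots> \<le> (\<Sum>n=1..m. t\<^sup>2 / 2 * \<bar>x n - x (Suc n)\<bar>)"
  proof (rule sum_norm_le)
    fix n assume n: "n \<in> {1..m}"
    show "cmod (of_real (S n) * (f n - f (Suc n)) - \<i> * of_real t * f n) \<le> t\<^sup>2 / 2 * \<bar>x n - x (Suc n)\<bar>"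
      using stein_step[OF S(1)[OF n], of t "x n"] unfolding f_def S(2)[OF n] by simp
  qed
  also have "\<dots> = t\<^sup>2 / 2 * \<bar>x 1 - x N\<bar>"
    using mon unfolding m sum_distrib_left[symmetric] by (subst monotonic_sum_abs_diff) auto
  also have "\<dots> \<le> t\<^sup>2 / 2 * (2 * sqrt N)"
    using abs_le[of 1] abs_le[of N] \<open>1 \<le> N\<close> by (intro mult_left_mono) auto
  finally have 1: "cmod ((\<Sum>n=1..N. of_real (x n) * f n) - \<i> * of_real t * (\<Sum>n=1..m. f n)) \<le> t\<^sup>2 * sqrt N"
    by simp
  \<comment> \<open>Summation by parts yields derivative terms only up to \<open>m = N - 1\<close>;
    the missing one at \<open>N\<close> is paid for here.\<close>
  have "cmod (\<i> * of_real t * f N) = \<bar>t\<bar>" by (simp add: norm_mult f_def)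
  also have "\<dots> \<le> \<bar>t\<bar> * sqrt N" using \<open>1 \<le> N\<close> by (simp add: mult_le_cancel_left1)
  finally have 2: "cmod (\<i> * of_real t * f N) \<le> \<bar>t\<bar> * sqrt N" .
  have "(\<Sum>n=1..N. of_real (x n) * f n) - \<i> * of_real t * (\<Sum>n=1..N. f n) =
     ((\<Sum>n=1..N. of_real (x n) * f n) - \<i> * of_real t * (\<Sum>n=1..m. f n)) - \<i> * of_real t * f N"
    unfolding m by (simp add: algebra_simps)
  also have "cmod \<dots> \<le> t\<^sup>2 * sqrt N + \<bar>t\<bar> * sqrt N"
    using norm_triangle_ineq4 1 2 by (rule order_trans[OF _ add_mono])
  finally show ?thesis by (simp add: f_def algebra_simps)
qed

section \<open>Characteristic functions and the limit law\<close>

lemma char_empirical_distribution: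
  assumes "1 \<le> N"
  shows "char (empirical_distribution N x) t = (\<Sum>n=1..N. iexp (t * x n)) / N"
proof -
  have meas: "x \<in> measurable (uniform_count_measure {1..N}) borel"
    by (auto simp: measurable_def space_uniform_count_measure sets_uniform_count_measure)
  have "char (empirical_distribution N x) t = (CLINT n|uniform_count_measure {1..N}. iexp (t * x n))"
    unfolding char_def empirical_distribution_def by (subst integral_distr[OF meas]) auto
  also have "\<dots> = (\<Sum>n=1..N. iexp (t * x n)) / N"
    unfolding uniform_count_measure_def
    by (subst lebesgue_integral_point_measure_finite)
       (auto simp: scaleR_conv_of_real sum_divide_distrib)
  finally show ?thesis .
qed

text \<open>The integrating factor \<open>exp (z\<^sup>2 / 2)\<close> turns the approximate equation
  \<open>F' = - z * F\<close> into a small derivative of \<open>G\<close>; the mean value inequality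
  from 0, where \<open>G\<close> is 1, then bounds \<open>G - 1\<close>.\<close>

lemma char_empirical_distribution_bound:
  assumes x: "monotonic_zero_mean_solution N x" and "1 \<le> N"
  shows "cmod (char (empirical_distribution N x) t - of_real (exp (- (t\<^sup>2) / 2)))
      \<le> (t\<^sup>2 + \<bar>t\<bar>) * \<bar>t\<bar> / sqrt N"
proof -
  \<comment> \<open>The characteristic function is extended to complex arguments so that the complex
    mean value inequality applies on a segment.\<close>
  define F where "F z = (\<Sum>n=1..N. exp (\<i> * (z * of_real (x n)))) / of_nat N" for z :: complex
  define F' where "F' z = (\<Sum>n=1..N. \<i> * of_real (x n) * exp (\<i> * (z * of_real (x n)))) / of_nat N"
    for z :: complex
  define G where "G z = exp (z\<^sup>2 / 2) * F z" for z
  have F: "(F has_field_derivative F' z) (at z within A)" for z A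
    unfolding F_def F'_def using \<open>1 \<le> N\<close>
    by (auto intro!: derivative_eq_intros sum.cong simp: mult_ac)
  have G: "(G has_field_derivative exp (z\<^sup>2 / 2) * (z * F z + F' z)) (at z within A)" for z A
    unfolding G_def by (auto intro!: derivative_eq_intros F simp: algebra_simps)
  have char_F: "char (empirical_distribution N x) s = F (of_real s)" for s
    using char_empirical_distribution[OF \<open>1 \<le> N\<close>] by (simp add: F_def)
  define B where "B = exp (t\<^sup>2 / 2) * ((t\<^sup>2 + \<bar>t\<bar>) / sqrt N)"
  have deriv_bound: "cmod (exp (z\<^sup>2 / 2) * (z * F z + F' z)) \<le> B" if z: "z \<in> closed_segment 0 (of_real t)" for z
  proof -
    obtain u where u: "0 \<le> u" "u \<le> 1" and zu: "z = of_real (u * t)"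
      using z by (auto simp: in_segment scaleR_conv_of_real)
    define s where "s = u * t"
    have "\<bar>s\<bar> \<le> \<bar>t\<bar>" using u by (simp add: s_def abs_mult mult_left_le_one_le)
    then have "s\<^sup>2 \<le> t\<^sup>2" by (simp add: abs_le_square_iff)
    have zs: "z = of_real s" by (simp add: zu s_def)
    \<comment> \<open>Up to the factor \<open>\<i> / N\<close> this is exactly the quantity
      estimated in \<open>stein_bound\<close>.\<close>
    have "z * F z + F' z = \<i> * ((\<Sum>n=1..N. of_real (x n) * iexp (s * x n)) -
        \<i> * of_real s * (\<Sum>n=1..N. iexp (s * x n))) / of_nat N"
      unfolding F_def F'_def zs
      by (simp add: algebra_simps sum_distrib_left sum_negf flip: add_divide_distrib)
    then have "cmod (z * F z + F' z) \<le> (s\<^sup>2 + \<bar>s\<bar>) * sqrt N / N"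
      using stein_bound[OF x \<open>1 \<le> N\<close>, of s]
      by (simp add: norm_mult norm_divide divide_right_mono)
    also have "\<dots> = (s\<^sup>2 + \<bar>s\<bar>) / sqrt N"
      using \<open>1 \<le> N\<close> by (simp add: field_simps)
    also have "\<dots> \<le> (t\<^sup>2 + \<bar>t\<bar>) / sqrt N"
      using \<open>\<bar>s\<bar> \<le> \<bar>t\<bar>\<close> \<open>s\<^sup>2 \<le> t\<^sup>2\<close> by (intro divide_right_mono add_mono) auto
    finally have 1: "cmod (z * F z + F' z) \<le> (t\<^sup>2 + \<bar>t\<bar>) / sqrt N" .
    have "cmod (exp (z\<^sup>2 / 2)) = exp (s\<^sup>2 / 2)"
      by (simp add: zs norm_exp_eq_Re flip: of_real_power)
    with 1 \<open>s\<^sup>2 \<le> t\<^sup>2\<close> show ?thesis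
      unfolding B_def norm_mult by (intro mult_mono) auto
  qed
  have "cmod (G (of_real t) - G 0) \<le> B * cmod (of_real t - 0)"
    by (rule field_differentiable_bound[of "closed_segment 0 (of_real t)"])
       (use G deriv_bound in auto)
  moreover have "G 0 = 1" using \<open>1 \<le> N\<close> by (simp add: G_def F_def)
  ultimately have GB: "cmod (G (of_real t) - 1) \<le> B * \<bar>t\<bar>" by simp
  have e: "exp (- (t\<^sup>2) / 2) * exp (t\<^sup>2 / 2) = (1::real)"
    by (simp flip: exp_add)
  have "F (of_real t) - of_real (exp (- (t\<^sup>2) / 2)) = of_real (exp (- (t\<^sup>2) / 2)) * (G (of_real t) - 1)"
  proof -
    have "of_real (exp (- (t\<^sup>2) / 2)) * exp ((of_real t)\<^sup>2 / 2) = (1::complex)"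
      using arg_cong[OF e, of complex_of_real] by (simp flip: exp_of_real)
    then show ?thesis by (simp add: G_def algebra_simps flip: mult.assoc)
  qed
  then have "cmod (F (of_real t) - of_real (exp (- (t\<^sup>2) / 2))) =
      exp (- (t\<^sup>2) / 2) * cmod (G (of_real t) - 1)"
    by (simp add: norm_mult del: of_real_exp)
  also have "\<dots> \<le> exp (- (t\<^sup>2) / 2) * (B * \<bar>t\<bar>)"
    using GB by (intro mult_left_mono) auto
  also have "\<dots> = (exp (- (t\<^sup>2) / 2) * exp (t\<^sup>2 / 2)) * ((t\<^sup>2 + \<bar>t\<bar>) * \<bar>t\<bar> / sqrt N)"
    by (simp add: B_def)
  finally show ?thesis unfolding char_F e by simp
qed

lemma empirical_distribution_weak_conv:
  assumes x: "\<And>N. 3 \<le> N \<Longrightarrow> monotonic_zero_mean_solution N (x N)"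
  shows "weak_conv_m (\<lambda>N. empirical_distribution N (x N)) std_normal_distribution"
proof -
  \<comment> \<open>Levy's theorem needs every member of the sequence to be a distribution, and
    \<open>x N\<close> is constrained only for \<open>3 \<le> N\<close>; hence the shift.\<close>
  let ?M = "\<lambda>k. empirical_distribution (k + 3) (x (k + 3))"
  have "weak_conv_m ?M std_normal_distribution"
  proof (rule levy_continuity)
    show "real_distribution (?M k)" for k
      by (rule real_distribution_empirical_distribution) simp
    show "real_distribution std_normal_distribution"
      by (rule real_dist_normal_dist)
    fix t :: real
    let ?C = "(t\<^sup>2 + \<bar>t\<bar>) * \<bar>t\<bar>"
    have "(\<lambda>k. ?C / sqrt (real k)) \<longlonglongrightarrow> 0"
      by (intro tendsto_divide_0[OF tendsto_const] filterlim_at_top_imp_at_infinity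
          filterlim_compose[OF sqrt_at_top] filterlim_real_sequentially)
    then have "(\<lambda>k. ?C / sqrt (real (k + 3))) \<longlonglongrightarrow> 0" by (rule LIMSEQ_ignore_initial_segment)
    then have "(\<lambda>k. char (?M k) t - of_real (exp (- (t\<^sup>2) / 2))) \<longlonglongrightarrow> 0"
      by (rule Lim_null_comparison[rotated])
         (intro always_eventually allI char_empirical_distribution_bound x; simp)
    then show "(\<lambda>k. char (?M k) t) \<longlonglongrightarrow> char std_normal_distribution t"
      unfolding char_std_normal_distribution by (subst (asm) Lim_null[symmetric])
  qed
  then show ?thesis
    unfolding weak_conv_m_def weak_conv_def
    by (auto intro: LIMSEQ_offset[where k = 3])
qed

text \<open>The first conjunct guarantees that families as in the second exist; their orientation
  may vary with \<open>N\<close>.\<close>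

theorem theorem1:
  shows "(\<forall>N\<ge>3. \<exists>x. monotonic_zero_mean_solution N x \<and>
            (\<forall>y. monotonic_zero_mean_solution N y \<longrightarrow>
               (\<forall>n\<in>{1..N}. y n = x n) \<or> (\<forall>n\<in>{1..N}. y n = x (N + 1 - n)))) \<and>
         (\<forall>x :: nat \<Rightarrow> nat \<Rightarrow> real.
            (\<forall>N\<ge>3. monotonic_zero_mean_solution N (x N)) \<longrightarrow>
            weak_conv_m (\<lambda>N. empirical_distribution N (x N)) std_normal_distribution)"
  using monotonic_zero_mean_solution_ex_unique empirical_distribution_weak_conv by simp

end
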